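(* Let $b,h,h^-\in\omega^\omega$ and assume $h$ goes to infinity. Then there is $b^+\in\omega^\omega$ such that $\mathbf{LLc}(b,h)\preceq_T\mathbf{LPr}(b^+,h^-)$ and $\mathbf{ILc}(b,h)\preceq_T\mathbf{IPr}(b^+,h^-)$.
   Context: $\mathbf{R}\preceq_T\mathbf{R}'$ for relational systems $\mathbf{R}=\langle X,Y,\sqsubset\rangle$, $\mathbf{R}'=\langle X',Y',\sqsubset'\rangle$ means there are $\Phi_-:X\to X'$, $\Phi_+:Y'\to Y$ with $\Phi_-(x)\sqsubset'y'\Rightarrow x\sqsubset\Phi_+(y')$. For $b,h\in\omega^\omega$: $\prod b=\prod_nb(n)$, $\mathcal{S}(b,h)=\prod_n[b(n)]^{\leq h(n)}$, $\mathrm{Seq}_{<\omega}(b)=\bigcup_n\prod_{i<n}b(i)$. For $x\in\prod b$, $\varphi\in\mathcal{S}(b,h)$, $D\in[\omega]^\omega$: $x\in^\infty\varphi$ iff $x(n)\in\varphi(n)$ for infinitely many $n$; $x\in^*_D\varphi$ iff for almost all $n\in D$. $\mathbf{ILc}(b,h)=\langle\prod b,\mathcal{S}(b,h),\in^\infty\rangle$, $\mathbf{LLc}(b,h)=\langle\prod b,[\omega]^\omega\times\mathcal{S}(b,h),(x,(D,\varphi))\mapsto x\in^*_D\varphi\rangle$. A global $(b,h)$-predictor is a function $\pi$ on $\mathrm{Seq}_{<\omega}(b)$ with $\pi(\sigma)\subseteq b(n)$, $|\pi(\sigma)|\leq h(n)$ for $\sigma\in\prod_{i<n}b(i)$; $\mathcal{GPR}(b,h)$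 is the set of these; $f\sqsubset_D\pi$ iff $f(n)\in\pi(f\restriction n)$ for almost all $n\in D$. $\mathbf{LPr}(b,h)=\langle\prod b,[\omega]^\omega\times\mathcal{GPR}(b,h),(f,(D,\pi))\mapsto f\sqsubset_D\pi\rangle$, $\mathbf{IPr}(b,h)=\langle\prod b,\mathcal{GPR}(b,h),\sqsubset^\infty\rangle$ with $f\sqsubset^\infty\pi$ iff $f\sqsubset_D\pi$ for some $D\in[\omega]^\omega$. *)

theory Defs
  imports Complex_Main "HOL-Library.FuncSet" "HOL-Library.Infinite_Set"
begin

text \<open>A natural number \<open>m\<close>, viewed as the set of its predecessors, is rendered as \<open>{..<m}\<close>.\<close>

datatype ('x, 'y) rel_system =
  Rel_System (challenges: "'x set") (responses: "'y set") (related: "'x \<Rightarrow> 'y \<Rightarrow> bool")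

definition tukey_le :: "('x, 'y) rel_system \<Rightarrow> ('u, 'v) rel_system \<Rightarrow> bool" (infix "\<preceq>\<^sub>T" 50) where
  "R \<preceq>\<^sub>T R' \<longleftrightarrow>
     (\<exists>\<Phi>\<^sub>m \<in> challenges R \<rightarrow> challenges R'. \<exists>\<Phi>\<^sub>p \<in> responses R' \<rightarrow> responses R.
        \<forall>x \<in> challenges R. \<forall>y' \<in> responses R'.
          related R' (\<Phi>\<^sub>m x) y' \<longrightarrow> related R x (\<Phi>\<^sub>p y'))"

definition inf_sets :: "nat set set" where
  "inf_sets = {D. infinite D}"

definition prod_seq :: "(nat \<Rightarrow> nat) \<Rightarrow> (nat \<Rightarrow> nat) set" where
  "prod_seq b = (\<Pi> n\<in>UNIV. {..<b n})"

definition slaloms :: "(nat \<Rightarrow> nat) \<Rightarrow> (nat \<Rightarrow> nat) \<Rightarrow> (nat \<Rightarrow> nat set) set" where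
  "slaloms b h = (\<Pi> n\<in>UNIV. {A. A \<subseteq> {..<b n} \<and> card A \<le> h n})"

text \<open>Finite sequences are lists, so that \<open>length \<sigma>\<close> is the \<open>n\<close> with
  \<open>\<sigma> \<in> \<Prod>\<^bsub>i<n\<^esub> b(i)\<close> and \<open>map f [0..<n]\<close> is the restriction of \<open>f\<close> to \<open>n\<close>.\<close>

definition fin_seqs :: "(nat \<Rightarrow> nat) \<Rightarrow> nat list set" where
  "fin_seqs b = (\<Union>n. {\<sigma>. length \<sigma> = n \<and> (\<forall>i<n. \<sigma> ! i < b i)})"

definition global_predictors :: "(nat \<Rightarrow> nat) \<Rightarrow> (nat \<Rightarrow> nat) \<Rightarrow> (nat list \<Rightarrow> nat set) set" where
  "global_predictors b h =
     (\<Pi>\<^sub>E \<sigma>\<in>fin_seqs b. {A. A \<subseteq> {..<b (length \<sigma>)} \<and> card A \<le> h (length \<sigma>)})"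

definition inf_localized :: "(nat \<Rightarrow> nat) \<Rightarrow> (nat \<Rightarrow> nat set) \<Rightarrow> bool" where
  "inf_localized x \<phi> \<longleftrightarrow> (\<exists>\<^sub>\<infinity>n. x n \<in> \<phi> n)"

definition localized_on :: "nat set \<Rightarrow> (nat \<Rightarrow> nat) \<Rightarrow> (nat \<Rightarrow> nat set) \<Rightarrow> bool" where
  "localized_on D x \<phi> \<longleftrightarrow> (\<forall>\<^sub>\<infinity>n. n \<in> D \<longrightarrow> x n \<in> \<phi> n)"

definition predicted_on :: "nat set \<Rightarrow> (nat \<Rightarrow> nat) \<Rightarrow> (nat list \<Rightarrow> nat set) \<Rightarrow> bool" where
  "predicted_on D f \<pi> \<longleftrightarrow> (\<forall>\<^sub>\<infinity>n. n \<in> D \<longrightarrow> f n \<in> \<pi> (map f [0..<n]))"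

definition inf_predicted :: "(nat \<Rightarrow> nat) \<Rightarrow> (nat list \<Rightarrow> nat set) \<Rightarrow> bool" where
  "inf_predicted f \<pi> \<longleftrightarrow> (\<exists>D\<in>inf_sets. predicted_on D f \<pi>)"

definition ILc :: "(nat \<Rightarrow> nat) \<Rightarrow> (nat \<Rightarrow> nat) \<Rightarrow> (nat \<Rightarrow> nat, nat \<Rightarrow> nat set) rel_system" where
  "ILc b h = Rel_System (prod_seq b) (slaloms b h) inf_localized"

definition LLc :: "(nat \<Rightarrow> nat) \<Rightarrow> (nat \<Rightarrow> nat)
    \<Rightarrow> (nat \<Rightarrow> nat, nat set \<times> (nat \<Rightarrow> nat set)) rel_system" where
  "LLc b h = Rel_System (prod_seq b) (inf_sets \<times> slaloms b h) (\<lambda>x (D, \<phi>). localized_on D x \<phi>)"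

definition LPr :: "(nat \<Rightarrow> nat) \<Rightarrow> (nat \<Rightarrow> nat)
    \<Rightarrow> (nat \<Rightarrow> nat, nat set \<times> (nat list \<Rightarrow> nat set)) rel_system" where
  "LPr b h = Rel_System (prod_seq b) (inf_sets \<times> global_predictors b h)
     (\<lambda>f (D, \<pi>). predicted_on D f \<pi>)"

definition IPr :: "(nat \<Rightarrow> nat) \<Rightarrow> (nat \<Rightarrow> nat)
    \<Rightarrow> (nat \<Rightarrow> nat, nat list \<Rightarrow> nat set) rel_system" where
  "IPr b h = Rel_System (prod_seq b) (global_predictors b h) inf_predicted"

end

theory Submission imports Defs begin

text \<open>Choose \<open>j\<close> strictly increasing with
  \<open>h (j n) \<ge> h\<^sup>- n * (\<Prod>i<n. b (j i))\<close> and put \<open>b\<^sup>+ = b \<circ> j\<close>. A challenge \<open>x\<close> is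
  sent to \<open>x \<circ> j\<close>. There are only \<open>\<Prod>i<n. b (j i)\<close> sequences of length \<open>n\<close> bounded by \<open>b\<^sup>+\<close>,
  so all the guesses a predictor can make at stage \<open>n\<close>, over all possible pasts, fit together
  into one slalom entry at \<open>j n\<close>.\<close>

text \<open>A single level of \<open>fin_seqs\<close>: the pasts possible at stage \<open>n\<close>,
  isolated so that they can be counted.\<close>

definition bounded_lists :: "(nat \<Rightarrow> nat) \<Rightarrow> nat \<Rightarrow> nat list set" where
  "bounded_lists b n = {\<sigma>. length \<sigma> = n \<and> (\<forall>i<n. \<sigma> ! i < b i)}"

lemma fin_seqs_eq_bounded_lists: "fin_seqs b = (\<Union>n. bounded_lists b n)"
  by (simp add: fin_seqs_def bounded_lists_def)

lemma bounded_lists_Suc: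
  "bounded_lists b (Suc n) = (\<lambda>(\<sigma>, k). \<sigma> @ [k]) ` (bounded_lists b n \<times> {..<b n})"
proof (intro equalityI subsetI)
  fix \<sigma> assume "\<sigma> \<in> bounded_lists b (Suc n)"
  then have len: "length \<sigma> = Suc n" and lt: "\<And>i. i < Suc n \<Longrightarrow> \<sigma> ! i < b i"
    by (auto simp: bounded_lists_def)
  from len have eq: "\<sigma> = butlast \<sigma> @ [last \<sigma>]"
    by (metis append_butlast_last_id length_0_conv nat.distinct(1))
  have "last \<sigma> < b n"
    using len lt[of n] by (metis diff_Suc_1 last_conv_nth length_0_conv lessI nat.distinct(1))
  moreover have "butlast \<sigma> \<in> bounded_lists b n"
    using len lt by (auto simp: bounded_lists_def nth_butlast)
  ultimately show "\<sigma> \<in> (\<lambda>(\<sigma>, k). \<sigma> @ [k]) ` (bounded_lists b n \<times> {..<b n})"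
    by (subst eq) force
qed (auto simp: bounded_lists_def nth_append less_Suc_eq)

text \<open>Induction on the length, splitting off the last entry. Finiteness is carried along
  because \<open>card_image_le\<close> requires it in the induction step.\<close>

lemma finite_card_bounded_lists:
  "finite (bounded_lists b n) \<and> card (bounded_lists b n) \<le> (\<Prod>i<n. b i)"
proof (induction n)
  case 0
  have "bounded_lists b 0 = {[]}"
    by (auto simp: bounded_lists_def)
  then show ?case by simp
next
  case (Suc n)
  then have "card (bounded_lists b (Suc n)) \<le> card (bounded_lists b n \<times> {..<b n})"
    by (simp only: bounded_lists_Suc) (rule card_image_le, simp)
  also have "\<dots> \<le> (\<Prod>i<Suc n. b i)"
    using Suc by (simp add: card_cartesian_product)
  finally show ?case
    using Suc by (simp add: bounded_lists_Suc)
qed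

lemmas finite_bounded_lists = finite_card_bounded_lists[THEN conjunct1]
  and card_bounded_lists_le = finite_card_bounded_lists[THEN conjunct2]

lemma map_upt_in_bounded_lists:
  "f \<in> prod_seq b \<Longrightarrow> map f [0..<n] \<in> bounded_lists b n"
  by (auto simp: prod_seq_def bounded_lists_def)

lemma global_predictor_bounds:
  assumes "\<pi> \<in> global_predictors b h" "\<sigma> \<in> bounded_lists b n"
  shows "\<pi> \<sigma> \<subseteq> {..<b n}" "card (\<pi> \<sigma>) \<le> h n"
proof -
  have "\<sigma> \<in> fin_seqs b" "length \<sigma> = n"
    using assms(2) by (auto simp: fin_seqs_eq_bounded_lists bounded_lists_def)
  then show "\<pi> \<sigma> \<subseteq> {..<b n}" "card (\<pi> \<sigma>) \<le> h n"
    using PiE_mem[OF assms(1)[unfolded global_predictors_def]] by auto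
qed

text \<open>The parameter \<open>c\<close> is meant to be \<open>b \<circ> j\<close>. For injective
  \<open>j\<close>, \<open>inv j\<close> recovers the stage from its position. Off
  \<open>range j\<close> nothing has to be caught, and the empty set meets every size bound.\<close>

definition slalom_of_predictor ::
    "(nat \<Rightarrow> nat) \<Rightarrow> (nat \<Rightarrow> nat) \<Rightarrow> (nat list \<Rightarrow> nat set) \<Rightarrow> nat \<Rightarrow> nat set" where
  "slalom_of_predictor j c \<pi> t =
     (if t \<in> range j then \<Union> (\<pi> ` bounded_lists c (inv j t)) else {})"

text \<open>A union bound: at position \<open>j n\<close>, at most
  \<open>\<Prod>i<n. b (j i)\<close> pasts contribute at most \<open>g n\<close> guesses each, and
  the growth condition on \<open>j\<close> makes room for all of them.\<close>

lemma slalom_of_predictor_in_slaloms: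
  assumes "inj j" and bound: "\<And>n. g n * (\<Prod>i<n. b (j i)) \<le> h (j n)"
    and \<pi>: "\<pi> \<in> global_predictors (b \<circ> j) g"
  shows "slalom_of_predictor j (b \<circ> j) \<pi> \<in> slaloms b h"
proof -
  have "slalom_of_predictor j (b \<circ> j) \<pi> t \<subseteq> {..<b t}
      \<and> card (slalom_of_predictor j (b \<circ> j) \<pi> t) \<le> h t" for t
  proof (cases "t \<in> range j")
    case True
    then obtain n where t: "t = j n" by blast
    let ?S = "bounded_lists (b \<circ> j) n"
    have eq: "slalom_of_predictor j (b \<circ> j) \<pi> t = \<Union> (\<pi> ` ?S)"
      using \<open>inj j\<close> by (simp add: slalom_of_predictor_def t)
    have "card (\<Union> (\<pi> ` ?S)) \<le> (\<Sum>\<sigma>\<in>?S. card (\<pi> \<sigma>))"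
      by (rule card_UN_le) (rule finite_bounded_lists)
    also have "\<dots> \<le> card ?S * g n"
      using sum_bounded_above[of ?S "\<lambda>\<sigma>. card (\<pi> \<sigma>)" "g n"] global_predictor_bounds(2)[OF \<pi>]
      by simp
    also have "\<dots> \<le> g n * (\<Prod>i<n. b (j i))"
      using card_bounded_lists_le[of "b \<circ> j" n] by (simp add: mult.commute)
    also have "\<dots> \<le> h t"
      using bound t by simp
    finally show ?thesis
      using global_predictor_bounds(1)[OF \<pi>] eq t by fastforce
  qed (simp add: slalom_of_predictor_def)
  then show ?thesis
    by (auto simp: slaloms_def)
qed

text \<open>The true past of \<open>f\<close> is among the pasts over which the union is
  taken.\<close>

lemma in_slalom_of_predictor:
  assumes "inj j" "f \<in> prod_seq c" "f n \<in> \<pi> (map f [0..<n])"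
  shows "f n \<in> slalom_of_predictor j c \<pi> (j n)"
  using assms map_upt_in_bounded_lists by (auto simp: slalom_of_predictor_def)

lemma comp_in_prod_seq: "x \<in> prod_seq b \<Longrightarrow> x \<circ> j \<in> prod_seq (b \<circ> j)"
  by (auto simp: prod_seq_def)

text \<open>Stage \<open>n\<close> of the prediction becomes position \<open>j n\<close> of the
  slalom. Since \<open>j\<close> reflects the order, a threshold \<open>m\<close> for the prediction
  turns into the threshold \<open>j m\<close>.\<close>

lemma localized_on_image_if_predicted_on:
  assumes "strict_mono j" "x \<in> prod_seq b" "predicted_on D (x \<circ> j) \<pi>"
  shows "localized_on (j ` D) x (slalom_of_predictor j (b \<circ> j) \<pi>)"
proof -
  from assms(3) obtain m where
    m: "\<And>n. n \<ge> m \<Longrightarrow> n \<in> D \<Longrightarrow> (x \<circ> j) n \<in> \<pi> (map (x \<circ> j) [0..<n])"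
    by (auto simp: predicted_on_def MOST_nat_le)
  have "x t \<in> slalom_of_predictor j (b \<circ> j) \<pi> t" if "t \<ge> j m" "t \<in> j ` D" for t
  proof -
    from that obtain n where n: "t = j n" "n \<in> D" by blast
    with that assms(1) have "n \<ge> m" by (simp add: strict_mono_less_eq)
    with n m show ?thesis
      using in_slalom_of_predictor[OF strict_mono_imp_inj_on[OF assms(1)]
          comp_in_prod_seq[OF assms(2), of j], of n \<pi>] by simp
  qed
  then show ?thesis
    by (auto simp: localized_on_def MOST_nat_le)
qed

lemma inf_localized_if_localized_on:
  assumes "infinite D" "localized_on D x \<phi>"
  shows "inf_localized x \<phi>"
proof -
  have "\<exists>\<^sub>\<infinity>n. n \<in> D"
    using assms(1) by (simp add: INFM_iff_infinite)
  then show ?thesis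
    using assms(2) unfolding inf_localized_def localized_on_def
    by (rule frequently_rev_mp)
qed

text \<open>The product involves only values \<open>j i\<close> with \<open>i < n\<close>, so
  \<open>j n\<close> can be chosen recursively: as \<open>h\<close> tends to infinity, some position
  beyond the previous one is large enough.\<close>

lemma exists_strict_mono_dominating_past_product:
  fixes b g h :: "nat \<Rightarrow> nat"
  assumes "filterlim h at_top sequentially"
  obtains j where "strict_mono j" "\<And>n. g n * (\<Prod>i<n. b (j i)) \<le> h (j n)"
proof -
  have large: "\<exists>k>l. N \<le> h k" for l N
  proof -
    obtain m where "\<And>k. k \<ge> m \<Longrightarrow> N \<le> h k"
      using assms unfolding filterlim_at_top eventually_sequentially by blast
    then show ?thesis
      by (intro exI[of _ "max m (Suc l)"]) simp
  qed
  \<comment> \<open>Dependent choice sees only the preceding state, so the state is a pair: the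
    position \<open>j n\<close> and the product accumulated before it. The clause for
    \<open>n = 0\<close> fixes the empty product as 1.\<close>
  have "\<exists>s. \<forall>n. (g n * snd (s n) \<le> h (fst (s n)) \<and> (n = 0 \<longrightarrow> snd (s n) = 1))
      \<and> (fst (s n) < fst (s (Suc n)) \<and> snd (s (Suc n)) = snd (s n) * b (fst (s n)))"
  proof (rule dependent_nat_choice)
    obtain k where "g 0 * 1 \<le> h k"
      using large by blast
    then show "\<exists>p. g 0 * snd p \<le> h (fst p) \<and> (0 = (0::nat) \<longrightarrow> snd p = 1)"
      by (intro exI[of _ "(k, 1)"]) simp
  next
    fix p :: "nat \<times> nat" and n
    obtain k where "k > fst p" "g (Suc n) * (snd p * b (fst p)) \<le> h k"
      using large by blast
    then show "\<exists>q. (g (Suc n) * snd q \<le> h (fst q) \<and> (Suc n = 0 \<longrightarrow> snd q = 1))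
        \<and> (fst p < fst q \<and> snd q = snd p * b (fst p))"
      by (intro exI[of _ "(k, snd p * b (fst p))"]) simp
  qed
  then obtain s where s: "\<And>n. g n * snd (s n) \<le> h (fst (s n))" "snd (s 0) = 1"
    "\<And>n. fst (s n) < fst (s (Suc n))" "\<And>n. snd (s (Suc n)) = snd (s n) * b (fst (s n))"
    by blast
  have "snd (s n) = (\<Prod>i<n. b (fst (s i)))" for n
    by (induction n) (simp_all add: s)
  with s that[of "\<lambda>n. fst (s n)"] show thesis
    by (simp add: strict_mono_Suc_iff)
qed

theorem theorem4p6:
  fixes b h h_minus :: "nat \<Rightarrow> nat"
  assumes "filterlim h at_top sequentially"
  shows "\<exists>b_plus :: nat \<Rightarrow> nat.
    LLc b h \<preceq>\<^sub>T LPr b_plus h_minus \<and> ILc b h \<preceq>\<^sub>T IPr b_plus h_minus"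
proof -
  obtain j where j: "strict_mono j" "\<And>n. h_minus n * (\<Prod>i<n. b (j i)) \<le> h (j n)"
    using exists_strict_mono_dominating_past_product[OF assms, of h_minus b] by blast
  let ?c = "b \<circ> j" and ?S = "slalom_of_predictor j (b \<circ> j)"
  have inj: "inj j"
    using j(1) by (rule strict_mono_imp_inj_on)
  have inf_image: "infinite (j ` D)" if "infinite D" for D
    using that inj by (meson finite_imageD inj_on_subset subset_UNIV)
  note slalom = slalom_of_predictor_in_slaloms[where b = b and h = h, OF inj j(2)]
  note loc = localized_on_image_if_predicted_on[OF j(1)]
  have "LLc b h \<preceq>\<^sub>T LPr ?c h_minus"
    unfolding tukey_le_def LLc_def LPr_def rel_system.sel
  proof (intro bexI ballI impI)
    show "(\<lambda>x. x \<circ> j) \<in> prod_seq b \<rightarrow> prod_seq ?c"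
      by (auto intro: comp_in_prod_seq)
    \<comment> \<open>Stages in \<open>D\<close> are caught at their positions under
      \<open>j\<close>; the image stays infinite because \<open>j\<close> is injective.\<close>
    show "(\<lambda>(D, \<pi>). (j ` D, ?S \<pi>)) \<in>
        inf_sets \<times> global_predictors ?c h_minus \<rightarrow> inf_sets \<times> slaloms b h"
      by (auto simp: inf_sets_def intro: slalom dest: inf_image)
  qed (auto intro: loc)
  moreover have "ILc b h \<preceq>\<^sub>T IPr ?c h_minus"
    unfolding tukey_le_def ILc_def IPr_def rel_system.sel
  proof (intro bexI ballI impI)
    show "(\<lambda>x. x \<circ> j) \<in> prod_seq b \<rightarrow> prod_seq ?c"
      by (auto intro: comp_in_prod_seq)
    show "?S \<in> global_predictors ?c h_minus \<rightarrow> slaloms b h"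
      by (auto intro: slalom)
  next
    fix x \<pi> assume "x \<in> prod_seq b" "inf_predicted (x \<circ> j) \<pi>"
    \<comment> \<open>The set \<open>D\<close> may vary with \<open>x\<close>, but
      \<open>?S \<pi>\<close> is built without it, so one slalom serves every \<open>x\<close> that
      \<open>\<pi>\<close> predicts.\<close>
    then obtain D where "infinite D" "localized_on (j ` D) x (?S \<pi>)"
      by (auto simp: inf_predicted_def inf_sets_def dest: loc)
    then show "inf_localized x (?S \<pi>)"
      by (meson inf_image inf_localized_if_localized_on)
  qed
  ultimately show ?thesis by blast
qed

end
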